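(* Let $S,T$ be linear operators acting on a Hilbert space $\mathscr{H}$. Assume that (a) $S$ is essentially selfadjoint with $\operatorname{dom} S\subseteq\operatorname{dom} T$; (b) $\|Th\|^2\leq\|Sh\|^2+\|h\|^2$ for all $h\in\operatorname{dom} S$; (c) $(Th\,|\,k)=(h\,|\,Tk)$ for all $h,k\in\operatorname{dom} S$ (that is, the restriction of $T$ to $\operatorname{dom} S$ is symmetric). Then $S+T$ is essentially selfadjoint.
   Context: The Hilbert space may be real or complex. A linear operator is a possibly unbounded, not necessarily densely defined linear map defined on a linear subspace $\operatorname{dom}$. The scalar product is denoted $(\cdot\,|\,\cdot)$. The sum $S+T$ is defined on $\operatorname{dom}S\cap\operatorname{dom}T=\operatorname{dom}S$. An operator $S$ is symmetric if $(Sx\,|\,y)=(x\,|\,Sy)$ for all $x,y\in\operatorname{dom}S$; a densely defined operator $S$ is selfadjoint if $S=S^*$, and a densely defined symmetric operator is essentially selfadjoint if its closure is selfadjoint. *)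

theory Defs
  imports "HOL-Analysis.Analysis"
begin

text \<open>
  The types of this class are, up to isometric isomorphism of real algebras, exactly the fields of
  real and of complex numbers. A type variable of this class thus stands for ``\<open>\<real>\<close> or \<open>\<complex>\<close>''.
\<close>

class real_or_complex = real_normed_field +
  fixes to_complex :: "'a \<Rightarrow> complex"
  assumes to_complex_add: "to_complex (a + b) = to_complex a + to_complex b"
    and to_complex_mult: "to_complex (a * b) = to_complex a * to_complex b"
    and to_complex_scaleR: "to_complex (r *\<^sub>R a) = r *\<^sub>R to_complex a"
    and to_complex_one: "to_complex 1 = 1"
    and norm_to_complex: "cmod (to_complex a) = norm a"
    and range_to_complex: "range to_complex = \<real> \<or> range to_complex = UNIV"

instantiation real :: real_or_complex
begin

definition to_complex_real :: "real \<Rightarrow> complex"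
  where "to_complex_real = complex_of_real"

instance
  by standard (auto simp: to_complex_real_def Reals_def scaleR_conv_of_real)

end

instantiation complex :: real_or_complex
begin

definition to_complex_complex :: "complex \<Rightarrow> complex"
  where "to_complex_complex = id"

instance
  by standard (auto simp: to_complex_complex_def)

end

text \<open>
  Completeness, norm and topology are those of the class \<open>banach\<close>; the last assumption says that
  the norm is the one induced by the scalar product (so the latter is positive definite). The
  scalar product is linear in its first argument and conjugate symmetric.
\<close>

locale hilbert_space = vector_space scaleK
  for scaleK :: "'k::real_or_complex \<Rightarrow> 'a::banach \<Rightarrow> 'a" +
  fixes ip :: "'a \<Rightarrow> 'a \<Rightarrow> 'k"
  assumes scale_of_real: "scaleK (of_real r) x = r *\<^sub>R x"
    and ip_add_left: "ip (x + y) z = ip x z + ip y z"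
    and ip_scale_left: "ip (scaleK c x) y = c * ip x y"
    and ip_commute: "to_complex (ip x y) = cnj (to_complex (ip y x))"
    and ip_self: "ip x x = of_real ((norm x)\<^sup>2)"

lemma hilbert_space_real_inner:
  "hilbert_space scaleR (inner :: 'a::{real_inner,banach} \<Rightarrow> 'a \<Rightarrow> real)"
  by unfold_locales
    (auto simp: algebra_simps inner_add_left inner_commute to_complex_real_def dot_square_norm)

lemma hilbert_space_complex:
  "hilbert_space (*) (\<lambda>x y :: complex. x * cnj y)"
  by unfold_locales
    (auto simp: algebra_simps scaleR_conv_of_real to_complex_complex_def complex_norm_square
          simp del: of_real_power)

text \<open>
  An operator is a partial map, so that equality of operators includes equality of their domains.
  The value of \<open>S\<close> at \<open>h \<in> dom S\<close> is \<open>the (S h)\<close>.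
\<close>

type_synonym 'a operator = "'a \<rightharpoonup> 'a"

definition linear_operator ::
    "('k::real_or_complex \<Rightarrow> 'a::banach \<Rightarrow> 'a) \<Rightarrow> 'a operator \<Rightarrow> bool"
  where "linear_operator scaleK S \<longleftrightarrow>
    module.subspace scaleK (dom S) \<and>
    (\<forall>x\<in>dom S. \<forall>y\<in>dom S. the (S (x + y)) = the (S x) + the (S y)) \<and>
    (\<forall>c. \<forall>x\<in>dom S. the (S (scaleK c x)) = scaleK c (the (S x)))"

definition op_sum :: "'a::banach operator \<Rightarrow> 'a operator \<Rightarrow> 'a operator"
  where "op_sum S T =
    (\<lambda>h. if h \<in> dom S \<inter> dom T then Some (the (S h) + the (T h)) else None)"

definition densely_defined :: "'a::banach operator \<Rightarrow> bool"
  where "densely_defined S \<longleftrightarrow> closure (dom S) = UNIV"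

definition symmetric_operator ::
    "('a::banach \<Rightarrow> 'a \<Rightarrow> 'k::real_or_complex) \<Rightarrow> 'a operator \<Rightarrow> bool"
  where "symmetric_operator ip S \<longleftrightarrow>
    (\<forall>x\<in>dom S. \<forall>y\<in>dom S. ip (the (S x)) y = ip x (the (S y)))"

text \<open>
  The adjoint is meaningful for densely defined operators, where the vector \<open>l\<close> below is
  determined by \<open>k\<close>; see \<open>op_adjoint_eq_Some_iff\<close>.
\<close>

definition op_adjoint ::
    "('a::banach \<Rightarrow> 'a \<Rightarrow> 'k::real_or_complex) \<Rightarrow> 'a operator \<Rightarrow> 'a operator"
  where "op_adjoint ip S =
    (\<lambda>k. if \<exists>l. \<forall>h\<in>dom S. ip (the (S h)) k = ip h l
         then Some (THE l. \<forall>h\<in>dom S. ip (the (S h)) k = ip h l) else None)"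

text \<open>
  The closure is the operator whose graph is the closure of the graph. It is meaningful for
  closable operators, in particular for densely defined symmetric ones; see \<open>graph_op_closure\<close>.
\<close>

definition op_closure :: "'a::banach operator \<Rightarrow> 'a operator"
  where "op_closure S =
    (\<lambda>x. if \<exists>y. (x, y) \<in> closure (Map.graph S)
         then Some (THE y. (x, y) \<in> closure (Map.graph S)) else None)"

definition selfadjoint ::
    "('a::banach \<Rightarrow> 'a \<Rightarrow> 'k::real_or_complex) \<Rightarrow> 'a operator \<Rightarrow> bool"
  where "selfadjoint ip S \<longleftrightarrow> densely_defined S \<and> S = op_adjoint ip S"

definition essentially_selfadjoint ::
    "('a::banach \<Rightarrow> 'a \<Rightarrow> 'k::real_or_complex) \<Rightarrow> 'a operator \<Rightarrow> bool"
  where "essentially_selfadjoint ip S \<longleftrightarrow>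
    densely_defined S \<and> symmetric_operator ip S \<and> selfadjoint ip (op_closure S)"

lemma to_complex_eq_iff: "to_complex a = to_complex b \<longleftrightarrow> a = b"
proof
  assume "to_complex a = to_complex b"
  moreover have "to_complex (a - b) = to_complex a - to_complex b"
    using to_complex_add[of "a - b" b] by simp
  ultimately show "a = b"
    using norm_to_complex[of "a - b"] by simp
qed simp

context hilbert_space
begin

lemma ip_add_right: "ip x (y + z) = ip x y + ip x z"
proof -
  have "to_complex (ip x (y + z)) = to_complex (ip x y + ip x z)"
    by (simp add: ip_commute[of x] ip_add_left to_complex_add)
  then show ?thesis by (simp only: to_complex_eq_iff)
qed

lemma ip_diff_left: "ip (x - y) z = ip x z - ip y z"
  using ip_add_left[of "x - y" y z] by simp

lemma ip_diff_right: "ip x (y - z) = ip x y - ip x z"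
  using ip_add_right[of x "y - z" z] by simp

lemma norm_ip_le: "norm (ip x y) \<le> norm x * norm y"
proof (cases "y = 0")
  case True
  then show ?thesis using ip_diff_right[of x 0 0] by simp
next
  case False
  define c where "c = ip x y"
  define n where "n = (norm y)\<^sup>2"
  have n: "n > 0" using False by (simp add: n_def)
  define u where "u = n *\<^sub>R x - scaleK c y"
  have sc: "n *\<^sub>R x = scaleK (of_real n) x" by (simp add: scale_of_real)
  have tof: "to_complex (of_real r :: 'k) = of_real r" for r
    using to_complex_scaleR[of r "1::'k"] by (simp add: to_complex_one scaleR_conv_of_real)
  have uy: "ip u y = 0"
    unfolding u_def sc by (simp add: ip_diff_left ip_scale_left ip_self c_def n_def)
  then have yu: "ip y u = 0"
  proof -
    have "to_complex (ip y u) = to_complex (ip u y)"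
      using ip_commute[of y u] uy tof[of 0] by simp
    then show ?thesis using uy by (simp add: to_complex_eq_iff)
  qed
  have "of_real ((norm (n *\<^sub>R x))\<^sup>2) = (ip (u + scaleK c y) (u + scaleK c y))"
    by (simp only: ip_self[symmetric] u_def) simp
  also have "\<dots> = ip u u + ip (scaleK c y) (scaleK c y) + ip u (scaleK c y) + c * ip y u"
    by (simp add: ip_add_left ip_add_right ip_scale_left)
  also have "ip u (scaleK c y) = 0"
  proof -
    have "to_complex (ip u (scaleK c y)) = 0"
      using ip_commute[of u "scaleK c y"] yu tof[of 0] by (simp add: ip_scale_left)
    then show ?thesis using tof[of 0] to_complex_eq_iff[of _ "0::'k"] by simp
  qed
  also have "c * ip y u = 0" using yu by simp
  finally have "(of_real ((norm (n *\<^sub>R x))\<^sup>2) :: 'k)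
      = of_real ((norm u)\<^sup>2 + (norm (scaleK c y))\<^sup>2)"
    by (simp only: ip_self of_real_add) simp
  then have le: "(norm (n *\<^sub>R x))\<^sup>2 \<ge> (norm (scaleK c y))\<^sup>2"
    by (simp only: of_real_eq_iff) simp
  have "norm (ip (scaleK c y) (scaleK c y)) = norm c * norm (ip y (scaleK c y))"
    by (simp add: ip_scale_left norm_mult)
  also have "norm (ip y (scaleK c y)) = norm (ip (scaleK c y) y)"
    by (metis ip_commute norm_to_complex complex_mod_cnj)
  also have "\<dots> = norm c * n"
    by (simp add: ip_scale_left norm_mult ip_self n_def norm_power)
  finally have "(norm (scaleK c y))\<^sup>2 = (norm c)\<^sup>2 * n"
    by (simp add: ip_self norm_mult power2_eq_square)
  with le have "(norm c)\<^sup>2 * n \<le> n\<^sup>2 * (norm x)\<^sup>2"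
    by (simp add: power_mult_distrib)
  then have "n * (norm c)\<^sup>2 \<le> n * (n * (norm x)\<^sup>2)"
    by (simp add: power2_eq_square mult.assoc mult.left_commute mult.commute)
  then have "(norm c)\<^sup>2 \<le> n * (norm x)\<^sup>2"
    using n by (simp only: mult_le_cancel_left_pos)
  also have "\<dots> = (norm x * norm y)\<^sup>2"
    by (simp add: n_def power_mult_distrib)
  finally show ?thesis
    unfolding c_def by (rule power2_le_imp_le) simp
qed

lemma bounded_linear_ip_left: "bounded_linear (\<lambda>x. ip x y)"
proof (rule bounded_linear_intro)
  show "ip (r *\<^sub>R x) y = r *\<^sub>R ip x y" for r x
    using ip_scale_left[of "of_real r" x y] by (simp add: scale_of_real scaleR_conv_of_real)
qed (rule ip_add_left norm_ip_le)+

lemma bounded_linear_ip_right: "bounded_linear (ip x)"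
proof (rule bounded_linear_intro)
  show "ip x (r *\<^sub>R y) = r *\<^sub>R ip x y" for r y
  proof -
    have "to_complex (ip x (r *\<^sub>R y)) = cnj (to_complex (r *\<^sub>R ip y x))"
      using ip_scale_left[of "of_real r" y x] ip_commute[of x "r *\<^sub>R y"]
      by (simp add: scale_of_real scaleR_conv_of_real)
    also have "\<dots> = to_complex (r *\<^sub>R ip x y)"
      by (simp add: to_complex_scaleR ip_commute[of x y])
    finally show ?thesis by (simp only: to_complex_eq_iff)
  qed
  show "norm (ip x y) \<le> norm y * norm x" for y
    using norm_ip_le[of x y] by (simp add: mult.commute)
qed (rule ip_add_right)

lemma dense_ip_eq:
  assumes dense: "closure D = UNIV" and eq: "\<And>h. h \<in> D \<Longrightarrow> ip h l = ip h m"
  shows "l = m"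
proof -
  have "closed {h. ip h (l - m) = 0}"
    by (intro closed_Collect_eq linear_continuous_on bounded_linear_ip_left continuous_on_const)
  moreover have "D \<subseteq> {h. ip h (l - m) = 0}" using eq by (auto simp: ip_diff_right)
  ultimately have "ip (l - m) (l - m) = 0"
    using closure_minimal dense by blast
  then show ?thesis by (simp add: ip_self)
qed

lemma op_adjoint_eq_Some_iff:
  assumes "densely_defined S"
  shows "op_adjoint ip S k = Some l \<longleftrightarrow> (\<forall>h\<in>dom S. ip (the (S h)) k = ip h l)"
proof -
  have uniq: "l = m" if "\<forall>h\<in>dom S. ip (the (S h)) k = ip h l"
    "\<forall>h\<in>dom S. ip (the (S h)) k = ip h m" for l m
    using that assms by (intro dense_ip_eq[of "dom S"]) (auto simp: densely_defined_def)
  have the: "(THE m. \<forall>h\<in>dom S. ip (the (S h)) k = ip h m) = l"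
    if "\<forall>h\<in>dom S. ip (the (S h)) k = ip h l" for l
    using that uniq by (intro the_equality) blast+
  show ?thesis
  proof
    assume "op_adjoint ip S k = Some l"
    then show "\<forall>h\<in>dom S. ip (the (S h)) k = ip h l"
      using the by (auto simp: op_adjoint_def split: if_splits)
  next
    assume l: "\<forall>h\<in>dom S. ip (the (S h)) k = ip h l"
    then show "op_adjoint ip S k = Some l"
      using the[OF l] unfolding op_adjoint_def by auto
  qed
qed

lemma graph_op_closure:
  assumes dense: "densely_defined S" and sym: "symmetric_operator ip S"
  shows "Map.graph (op_closure S) = closure (Map.graph S)"
proof -
  have clos: "ip y h = ip x (the (S h))" if "(x, y) \<in> closure (Map.graph S)" "h \<in> dom S" for x y h
  proof -
    let ?C = "{p. ip (snd p) h = ip (fst p) (the (S h))}"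
    have "closed ?C"
      by (intro closed_Collect_eq bounded_linear.continuous_on[OF bounded_linear_ip_left]
          continuous_intros)
    moreover have "Map.graph S \<subseteq> ?C"
      using sym that(2) by (force simp: symmetric_operator_def graph_def)
    ultimately have "closure (Map.graph S) \<subseteq> ?C" by (rule closure_minimal[rotated])
    with that(1) show ?thesis by auto
  qed
  have uniq: "y = z" if "(x, y) \<in> closure (Map.graph S)" "(x, z) \<in> closure (Map.graph S)" for x y z
  proof (rule dense_ip_eq[of "dom S"])
    fix h assume "h \<in> dom S"
    then have "ip y h = ip z h" using clos that by simp
    then show "ip h y = ip h z" by (metis ip_commute to_complex_eq_iff)
  qed (use dense in \<open>simp add: densely_defined_def\<close>)
  have the: "(THE z. (x, z) \<in> closure (Map.graph S)) = y"
    if "(x, y) \<in> closure (Map.graph S)" for x y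
    using that uniq by (intro the_equality) blast+
  have "op_closure S x = Some y \<longleftrightarrow> (x, y) \<in> closure (Map.graph S)" for x y
    using the unfolding op_closure_def by (metis option.distinct(1) option.inject)
  then show ?thesis
    by (auto simp: graph_def[of "op_closure S"])
qed

end

end

theory Submission imports Defs begin

text \<open>
  This is Wuest's theorem, the limiting case of the Kato--Rellich theorem in which the relative
  bound of the perturbation is one. In a complex space one would prove that \<open>S + T \<plusminus> i\<close> have
  dense range. To treat real spaces at the same time, the imaginary unit is replaced by a rotation:
  on the square of the Hilbert space let \<open>op_rot A (x, y) = (A x + y, A y - x)\<close>, that is, the
  diagonal operator \<open>op_diag A\<close> plus the rotation \<open>(x, y) \<mapsto> (y, -x)\<close>. For symmetric \<open>A\<close> the
  mixed terms cancel, and \<open>norm_rotated_sq\<close> gives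
  \<open>\<parallel>op_rot A p\<parallel>\<^sup>2 = \<parallel>op_diag A p\<parallel>\<^sup>2 + \<parallel>p\<parallel>\<^sup>2\<close>.

  A densely defined symmetric linear operator \<open>A\<close> is essentially selfadjoint exactly when
  \<open>op_rot A\<close> has dense range (\<open>essentially_selfadjoint_iff_dense_ran\<close>). Indeed, \<open>(y, z)\<close> is
  orthogonal to this range iff \<open>A\<^sup>* y = z\<close> and \<open>A\<^sup>* z = -y\<close>, which in turn says that \<open>(y, z)\<close>
  lies in the graph of \<open>A\<^sup>*\<close> and is orthogonal to the graph of \<open>A\<close>. Such pairs measure how much
  larger the graph of \<open>A\<^sup>*\<close> is than the closure of the graph of \<open>A\<close>.

  So dense range has to pass from \<open>B = op_rot S\<close> to \<open>op_rot (S + T) = B + C\<close> with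
  \<open>C = op_diag T\<close>. By the norm identity the bound on \<open>T\<close> reads \<open>\<parallel>C h\<parallel> \<le> \<parallel>B h\<parallel>\<close>. For
  \<open>0 \<le> t < 1\<close> the range of \<open>B + t C\<close> is dense because \<open>t C\<close> is a strict contraction relative to
  \<open>B\<close> (\<open>dense_ran_sum_contraction\<close>). For \<open>t \<rightarrow> 1\<close>, let \<open>w\<close> be orthogonal to the range of \<open>B + C\<close> and
  choose \<open>h\<^sub>t\<close> such that \<open>(B + t C) h\<^sub>t\<close> is close to \<open>w\<close>. Up to an error that tends to zero,
  \<open>\<parallel>w\<parallel>\<^sup>2\<close> is then the scalar product of \<open>-(1 - t) C h\<^sub>t\<close> with \<open>w\<close>. The vectors
  \<open>(1 - t) C h\<^sub>t\<close> are bounded, and the \<open>h\<^sub>t\<close> are bounded by the norm identity, so symmetry of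
  \<open>C\<close> makes \<open>(1 - t) C h\<^sub>t\<close> converge weakly to zero; hence \<open>w = 0\<close>
  (\<open>dense_ran_sum_borderline\<close>).
\<close>

section \<open>Sums and multiples of operators\<close>

lemma dom_op_sum: "dom (op_sum S T) = dom S \<inter> dom T"
  by (auto simp: op_sum_def split: if_splits)

lemma the_op_sum: "h \<in> dom S \<Longrightarrow> h \<in> dom T \<Longrightarrow> the (op_sum S T h) = the (S h) + the (T h)"
  by (auto simp: op_sum_def)

definition op_scale :: "real \<Rightarrow> 'a::banach operator \<Rightarrow> 'a operator"
  where "op_scale t C = (\<lambda>h. map_option (\<lambda>v. t *\<^sub>R v) (C h))"

lemma dom_op_scale [simp]: "dom (op_scale t C) = dom C"
  by (auto simp: op_scale_def)

lemma the_op_scale: "h \<in> dom C \<Longrightarrow> the (op_scale t C h) = t *\<^sub>R the (C h)"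
  by (auto simp: op_scale_def)

section \<open>Orthogonal projection\<close>

context hilbert_space
begin

lemma ip_zero_commute: "ip x y = 0 \<longleftrightarrow> ip y x = 0"
  by (metis norm_to_complex ip_commute complex_mod_cnj norm_eq_zero)

lemma ip_scaleR: "ip (r *\<^sub>R x) y = r *\<^sub>R ip x y" "ip x (r *\<^sub>R y) = r *\<^sub>R ip x y"
  using linear_scale[OF bounded_linear.linear[OF bounded_linear_ip_left]]
    linear_scale[OF bounded_linear.linear[OF bounded_linear_ip_right]] by auto

lemma norm_add_sq_orthogonal:
  assumes "ip x y = 0"
  shows "(norm (x + y))\<^sup>2 = (norm x)\<^sup>2 + (norm y)\<^sup>2"
proof -
  have "(of_real ((norm (x + y))\<^sup>2) :: 'k) = of_real ((norm x)\<^sup>2 + (norm y)\<^sup>2)"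
    using assms ip_zero_commute[of x y]
    by (simp only: ip_self[symmetric] of_real_add) (simp add: ip_add_left ip_add_right)
  then show ?thesis by (simp only: of_real_eq_iff)
qed

lemma parallelogram:
  fixes x y :: 'a
  shows "(norm (x + y))\<^sup>2 + (norm (x - y))\<^sup>2 = 2 * (norm x)\<^sup>2 + 2 * (norm y)\<^sup>2"
proof -
  have "(of_real ((norm (x + y))\<^sup>2 + (norm (x - y))\<^sup>2) :: 'k)
      = of_real ((norm x)\<^sup>2 + (norm x)\<^sup>2 + ((norm y)\<^sup>2 + (norm y)\<^sup>2))"
    unfolding of_real_add ip_self[symmetric]
    by (simp add: ip_add_left ip_add_right ip_diff_left ip_diff_right)
  then show ?thesis by (simp only: of_real_eq_iff)
qed

lemma scaleR_mem_subspace: "subspace M \<Longrightarrow> x \<in> M \<Longrightarrow> r *\<^sub>R x \<in> M"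
  by (metis scale_of_real subspace_scale)

text \<open>
  Subtracting from \<open>w\<close> its component along \<open>m\<close> strictly shortens it unless that component
  vanishes.
\<close>

lemma orthogonal_if_norm_minimal:
  assumes "\<And>c. norm w \<le> norm (w - scaleK c m)"
  shows "ip w m = 0"
proof (cases "m = 0")
  case True
  then show ?thesis using ip_diff_right[of w 0 0] by simp
next
  case False
  define c where "c = ip w m / of_real ((norm m)\<^sup>2)"
  define u where "u = w - scaleK c m"
  have "ip u m = 0"
    using False by (simp add: u_def ip_diff_left ip_scale_left ip_self c_def)
  then have "ip (scaleK c m) u = 0"
    using ip_zero_commute[of u m] by (simp add: ip_scale_left)
  then have "(norm (u + scaleK c m))\<^sup>2 = (norm u)\<^sup>2 + (norm (scaleK c m))\<^sup>2"
    by (intro norm_add_sq_orthogonal) (simp add: ip_zero_commute)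
  moreover have "(norm w)\<^sup>2 \<le> (norm u)\<^sup>2"
    using assms unfolding u_def by (intro power_mono) auto
  ultimately have "scaleK c m = 0" by (simp add: u_def)
  then show ?thesis using False by (simp add: c_def)
qed

text \<open>
  A sequence in \<open>M\<close> whose distances from \<open>z\<close> tend to the infimum is Cauchy: by the parallelogram
  law, two far apart members would have a midpoint in \<open>M\<close> closer to \<open>z\<close> than the infimum. Its
  limit \<open>p\<close> realises the infimum, so \<open>z - p\<close> cannot be shortened by elements of \<open>M\<close>.
\<close>

lemma orthogonal_projection:
  assumes M: "subspace M"
  obtains p where "p \<in> closure M" "\<And>m. m \<in> M \<Longrightarrow> ip m (z - p) = 0"
proof -
  define d where "d = infdist z M"
  have ne: "M \<noteq> {}" using subspace_0[OF M] by auto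
  have d0: "d \<ge> 0" by (simp add: d_def infdist_nonneg)
  have dle: "d \<le> norm (z - m)" if "m \<in> M" for m
    using infdist_le[OF that, of z] by (simp add: d_def dist_norm)
  have "\<exists>m\<in>M. norm (z - m) < d + 1 / Suc n" for n
    using cInf_lessD[of "(\<lambda>a. dist z a) ` M" "d + 1 / Suc n"] ne
    by (auto simp: d_def infdist_def dist_norm)
  then obtain f where fM: "\<And>n. f n \<in> M" and fd: "\<And>n. norm (z - f n) < d + 1 / Suc n"
    by metis
  have lim: "(\<lambda>n. d + 1 / Suc n) \<longlonglongrightarrow> d"
    using tendsto_add[OF tendsto_const[of d] LIMSEQ_inverse_real_of_nat]
    by (simp add: inverse_eq_divide)
  have lim2: "(\<lambda>n. 4 * ((d + 1 / Suc n)\<^sup>2 - d\<^sup>2)) \<longlonglongrightarrow> 4 * (d\<^sup>2 - d\<^sup>2)"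
    by (intro tendsto_intros lim)
  have dist_le: "(norm (f i - f j))\<^sup>2 \<le> 4 * ((d + 1 / Suc n)\<^sup>2 - d\<^sup>2)" if "n \<le> i" "n \<le> j" for i j n
  proof -
    have up: "(norm (z - f k))\<^sup>2 \<le> (d + 1 / Suc n)\<^sup>2" if "n \<le> k" for k
    proof -
      have "1 / real (Suc k) \<le> 1 / real (Suc n)" using that by (intro divide_left_mono) auto
      then show ?thesis using fd[of k] d0 by (intro power_mono) auto
    qed
    have "(1/2) *\<^sub>R (f i + f j) \<in> M"
      by (intro scaleR_mem_subspace subspace_add M fM)
    from dle[OF this] have "2 * d \<le> norm (2 *\<^sub>R (z - (1/2) *\<^sub>R (f i + f j)))" by simp
    also have "2 *\<^sub>R (z - (1/2) *\<^sub>R (f i + f j)) = (z - f i) + (z - f j)"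
      by (simp add: algebra_simps scaleR_2)
    finally have "(2 * d)\<^sup>2 \<le> (norm ((z - f i) + (z - f j)))\<^sup>2"
      using d0 by (intro power_mono) auto
    moreover have "(norm ((z - f i) - (z - f j)))\<^sup>2 = (norm (f i - f j))\<^sup>2"
      by (simp add: norm_minus_commute)
    ultimately show ?thesis
      using parallelogram[of "z - f i" "z - f j"] up[OF that(1)] up[OF that(2)]
      by (simp add: power_mult_distrib)
  qed
  have "Cauchy f"
  proof (rule metric_CauchyI)
    fix e :: real assume e: "e > 0"
    then have "\<forall>\<^sub>F n in sequentially. 4 * ((d + 1 / Suc n)\<^sup>2 - d\<^sup>2) < e\<^sup>2"
      using lim2 by (intro order_tendstoD(2)[OF lim2]) simp
    then obtain n where n: "4 * ((d + 1 / Suc n)\<^sup>2 - d\<^sup>2) < e\<^sup>2"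
      by (auto simp: eventually_sequentially)
    have "dist (f i) (f j) < e" if "n \<le> i" "n \<le> j" for i j
      using dist_le[OF that] n e by (auto simp: dist_norm intro: power2_less_imp_less)
    then show "\<exists>n. \<forall>i\<ge>n. \<forall>j\<ge>n. dist (f i) (f j) < e" by blast
  qed
  then obtain p where p: "f \<longlonglongrightarrow> p" using Cauchy_convergent convergent_def by blast
  have "p \<in> closure M" using p fM closure_sequential by blast
  moreover have "ip m (z - p) = 0" if m: "m \<in> M" for m
  proof -
    have "(\<lambda>n. norm (z - f n)) \<longlonglongrightarrow> norm (z - p)" by (intro tendsto_intros p)
    then have "norm (z - p) \<le> d"
      by (rule LIMSEQ_le[OF _ lim]) (use fd less_imp_le in blast)
    moreover have "d \<le> norm (z - p - scaleK c m)" for c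
    proof (rule LIMSEQ_le_const)
      show "(\<lambda>n. norm (z - f n - scaleK c m)) \<longlonglongrightarrow> norm (z - p - scaleK c m)"
        by (intro tendsto_intros p)
      have "d \<le> norm (z - (f n + scaleK c m))" for n
        by (intro dle subspace_add subspace_scale M fM m)
      then show "\<exists>N. \<forall>n\<ge>N. d \<le> norm (z - f n - scaleK c m)" by (simp add: diff_diff_eq)
    qed
    ultimately show ?thesis
      using orthogonal_if_norm_minimal[of "z - p" m] ip_zero_commute order_trans by blast
  qed
  ultimately show thesis using that by blast
qed

section \<open>Operators with dense range\<close>

lemma subspace_ran:
  assumes "linear_operator scaleK B"
  shows "subspace (ran B)"
proof (rule subspaceI)
  have D: "subspace (dom B)"
    and add: "\<And>x y. x \<in> dom B \<Longrightarrow> y \<in> dom B \<Longrightarrow> the (B (x + y)) = the (B x) + the (B y)"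
    and sc: "\<And>c x. x \<in> dom B \<Longrightarrow> the (B (scaleK c x)) = scaleK c (the (B x))"
    using assms by (auto simp: linear_operator_def)
  have ran: "v \<in> ran B \<longleftrightarrow> (\<exists>x\<in>dom B. v = the (B x))" for v by (force simp: ran_def dom_def)
  have "the (B (scaleK 0 0)) = 0" using sc[of 0 0] subspace_0[OF D] by simp
  then show "0 \<in> ran B" using subspace_0[OF D] unfolding ran by (intro bexI[of _ 0]) simp_all
  show "x + y \<in> ran B" if xy: "x \<in> ran B" "y \<in> ran B" for x y
  proof -
    obtain u v where uv: "u \<in> dom B" "x = the (B u)" "v \<in> dom B" "y = the (B v)"
      using xy unfolding ran by blast
    then show ?thesis unfolding ran by (intro bexI[of _ "u + v"]) (simp_all add: add subspace_add[OF D])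
  qed
  show "scaleK c x \<in> ran B" if x: "x \<in> ran B" for x c
  proof -
    obtain u where u: "u \<in> dom B" "x = the (B u)"
      using x unfolding ran by blast
    then show ?thesis unfolding ran by (intro bexI[of _ "scaleK c u"]) (simp_all add: sc subspace_scale[OF D])
  qed
qed

lemma dense_ran_iff:
  assumes "linear_operator scaleK B"
  shows "closure (ran B) = UNIV \<longleftrightarrow> (\<forall>w. (\<forall>h\<in>dom B. ip (the (B h)) w = 0) \<longrightarrow> w = 0)"
proof
  assume dense: "closure (ran B) = UNIV"
  show "\<forall>w. (\<forall>h\<in>dom B. ip (the (B h)) w = 0) \<longrightarrow> w = 0"
  proof (intro allI impI)
    fix w assume w: "\<forall>h\<in>dom B. ip (the (B h)) w = 0"
    show "w = 0"
    proof (rule dense_ip_eq[OF dense])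
      show "ip h w = ip h 0" if "h \<in> ran B" for h
        using that w ip_diff_right[of h 0 0] by (force simp: ran_def)
    qed
  qed
next
  assume triv: "\<forall>w. (\<forall>h\<in>dom B. ip (the (B h)) w = 0) \<longrightarrow> w = 0"
  show "closure (ran B) = UNIV"
  proof (rule UNIV_eq_I[symmetric])
    fix z
    obtain p where p: "p \<in> closure (ran B)" "\<And>m. m \<in> ran B \<Longrightarrow> ip m (z - p) = 0"
      using orthogonal_projection[OF subspace_ran[OF assms], of z] by blast
    have "\<forall>h\<in>dom B. ip (the (B h)) (z - p) = 0"
    proof
      fix h assume "h \<in> dom B"
      then have "the (B h) \<in> ran B" by (auto intro: ranI)
      then show "ip (the (B h)) (z - p) = 0" by (rule p(2))
    qed
    then have "z - p = 0" using triv by blast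
    then show "z \<in> closure (ran B)" using p by simp
  qed
qed

lemma linear_operator_sum:
  assumes "linear_operator scaleK S" "linear_operator scaleK T"
  shows "linear_operator scaleK (op_sum S T)"
  using assms unfolding linear_operator_def dom_op_sum
  by (simp add: the_op_sum subspace_inter subspace_add subspace_scale scale_right_distrib ac_simps)

lemma linear_operator_scale:
  assumes "linear_operator scaleK C"
  shows "linear_operator scaleK (op_scale t C)"
  using assms unfolding linear_operator_def dom_op_scale
  by (simp add: the_op_scale subspace_add subspace_scale scale_right_distrib
      scale_of_real[symmetric] mult.commute)

text \<open>
  If \<open>w\<close> is orthogonal to the range of \<open>B + C\<close>, then \<open>(B h | w) = - (C h | w)\<close>, and this is at
  most \<open>t \<parallel>B h\<parallel> \<parallel>w\<parallel>\<close> in absolute value. As the vectors \<open>B h\<close> are dense, \<open>w\<close> itself may be put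
  in place of \<open>B h\<close>, so that \<open>\<parallel>w\<parallel>\<^sup>2 \<le> t \<parallel>w\<parallel>\<^sup>2\<close>.
\<close>

lemma dense_ran_sum_contraction:
  assumes B: "linear_operator scaleK B" and C: "linear_operator scaleK C"
    and dom: "dom B \<subseteq> dom C" and t: "t < 1"
    and le: "\<And>h. h \<in> dom B \<Longrightarrow> norm (the (C h)) \<le> t * norm (the (B h))"
    and dense: "closure (ran B) = UNIV"
  shows "closure (ran (op_sum B C)) = UNIV"
  unfolding dense_ran_iff[OF linear_operator_sum[OF B C]]
proof (intro allI impI)
  fix w assume w: "\<forall>h\<in>dom (op_sum B C). ip (the (op_sum B C h)) w = 0"
  have "norm (ip (the (B h)) w) \<le> t * norm (the (B h)) * norm w" if h: "h \<in> dom B" for h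
  proof -
    have "ip (the (B h)) w = - ip (the (C h)) w"
      using w h dom by (auto simp: dom_op_sum the_op_sum ip_add_left add_eq_0_iff2 iff del: domIff)
    then have "norm (ip (the (B h)) w) \<le> norm (the (C h)) * norm w" by (simp add: norm_ip_le)
    also have "\<dots> \<le> t * norm (the (B h)) * norm w" using le[OF h] by (simp add: mult_right_mono)
    finally show ?thesis .
  qed
  then have "ran B \<subseteq> {u. norm (ip u w) \<le> t * norm u * norm w}" by (force simp: ran_def)
  moreover have "closed {u. norm (ip u w) \<le> t * norm u * norm w}"
    by (intro closed_Collect_le continuous_intros linear_continuous_on bounded_linear_ip_left)
  ultimately have "norm (ip w w) \<le> t * norm w * norm w"
    using closure_minimal dense by blast
  then have "(1 - t) * (norm w)\<^sup>2 \<le> 0" by (simp add: ip_self norm_mult power2_eq_square algebra_simps)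
  then show "w = 0" using t by (simp add: mult_le_0_iff)
qed

text \<open>
  For relative bound one the previous argument only yields \<open>\<parallel>w\<parallel>\<^sup>2 \<le> \<parallel>w\<parallel>\<^sup>2\<close>. It is applied to
  \<open>B + t C\<close> instead, and the limit \<open>t \<rightarrow> 1\<close> is controlled by weak convergence. The lower bound for
  \<open>B + t C\<close>, uniform in \<open>t\<close>, keeps approximate preimages of \<open>w\<close> bounded.
\<close>

lemma dense_ran_sum_borderline:
  assumes B: "linear_operator scaleK B" and C: "linear_operator scaleK C"
    and dom: "dom B \<subseteq> dom C" and dd: "densely_defined B"
    and le: "\<And>h. h \<in> dom B \<Longrightarrow> norm (the (C h)) \<le> norm (the (B h))"
    and sym: "\<And>h k. h \<in> dom B \<Longrightarrow> k \<in> dom B \<Longrightarrow> ip (the (C h)) k = ip h (the (C k))"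
    and below: "\<And>t h. 0 \<le> t \<Longrightarrow> t < 1 \<Longrightarrow> h \<in> dom B \<Longrightarrow> norm h \<le> norm (the (B h) + t *\<^sub>R the (C h))"
    and dense: "closure (ran B) = UNIV"
  shows "closure (ran (op_sum B C)) = UNIV"
  unfolding dense_ran_iff[OF linear_operator_sum[OF B C]]
proof (intro allI impI)
  fix w assume w: "\<forall>h\<in>dom (op_sum B C). ip (the (op_sum B C h)) w = 0"
  define N where "N = norm w + 1"
  \<comment> \<open>The single number \<open>s\<close> is both \<open>1 - t\<close> and the accuracy of the approximation of \<open>w\<close>; the
    vector \<open>k\<close> approximates \<open>w\<close> inside the domain, where symmetry of \<open>C\<close> is available.\<close>
  have est: "(norm w)\<^sup>2 \<le> s * norm w + (N * norm (w - k) + s * N * norm (the (C k)))"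
    if s: "0 < s" "s \<le> 1" and k: "k \<in> dom B" for s k
  proof -
    define t where "t = 1 - s"
    have t: "0 \<le> t" "t < 1" using s by (auto simp: t_def)
    have "closure (ran (op_sum B (op_scale t C))) = UNIV"
    proof (rule dense_ran_sum_contraction[OF B linear_operator_scale[OF C] _ t(2) _ dense])
      fix h assume h: "h \<in> dom B"
      then show "norm (the (op_scale t C h)) \<le> t * norm (the (B h))"
        using dom le[OF h] t by (auto simp: the_op_scale mult_left_mono subset_iff iff del: domIff)
    qed (simp add: dom)
    then have "w \<in> closure (ran (op_sum B (op_scale t C)))" by simp
    then obtain u where u: "u \<in> ran (op_sum B (op_scale t C))" "dist u w < s"
      using s(1) unfolding closure_approachable by blast
    from u(1) obtain h where hu: "op_sum B (op_scale t C) h = Some u" unfolding ran_def by blast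
    have "h \<in> dom B \<inter> dom C" using domI[of "op_sum B (op_scale t C)", OF hu] by (simp only: dom_op_sum dom_op_scale)
    then have h: "h \<in> dom B" and hC: "h \<in> dom C" by blast+
    have uh: "u = the (B h) + t *\<^sub>R the (C h)"
      using the_op_sum[of h B "op_scale t C"] h hC by (simp add: hu the_op_scale)
    \<comment> \<open>Both \<open>h\<close> and \<open>s C h\<close> are bounded by \<open>N\<close>, whatever \<open>s\<close> is.\<close>
    have nu: "norm u \<le> N"
      using u(2) s(2) norm_triangle_ineq2[of u w] by (simp add: N_def dist_norm)
    have nh: "norm h \<le> N" using below[OF t h] nu uh by simp
    have "norm (the (B h)) \<le> norm u + norm (t *\<^sub>R the (C h))"
      using norm_triangle_ineq4[of u "t *\<^sub>R the (C h)"] by (simp add: uh)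
    also have "norm (t *\<^sub>R the (C h)) \<le> t * norm (the (B h))"
      using t le[OF h] by (simp add: mult_left_mono)
    finally have "s * norm (the (B h)) \<le> norm u" by (simp add: t_def algebra_simps)
    then have sC: "s * norm (the (C h)) \<le> N"
      using nu mult_left_mono[OF le[OF h], of s] s by linarith
    \<comment> \<open>Modulo vectors orthogonal to \<open>w\<close>, \<open>u\<close> equals \<open>- s C h\<close>.\<close>
    have "u = the (op_sum B C h) - s *\<^sub>R the (C h)"
      using h hC by (simp add: uh the_op_sum t_def scaleR_diff_left)
    moreover have "ip (the (op_sum B C h)) w = 0" using w h hC unfolding dom_op_sum by blast
    ultimately have uw: "ip u w = - ip (s *\<^sub>R the (C h)) w" by (simp add: ip_diff_left)
    have "ip (s *\<^sub>R the (C h)) w = ip (s *\<^sub>R the (C h)) (w - k) + s *\<^sub>R ip h (the (C k))"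
      using sym[OF h k] by (simp add: ip_diff_right ip_scaleR scaleR_diff_right)
    then have "norm (ip u w) \<le> norm (ip (s *\<^sub>R the (C h)) (w - k)) + norm (s *\<^sub>R ip h (the (C k)))"
      unfolding uw by (simp only: norm_minus_cancel norm_triangle_ineq)
    also have "\<dots> \<le> (s * norm (the (C h))) * norm (w - k) + s * (norm h * norm (the (C k)))"
      using norm_ip_le[of "s *\<^sub>R the (C h)" "w - k"] norm_ip_le[of h "the (C k)"] s
      by (intro add_mono) (auto simp: mult_left_mono)
    also have "\<dots> \<le> N * norm (w - k) + s * (N * norm (the (C k)))"
      using sC nh s by (intro add_mono mult_right_mono mult_left_mono) auto
    finally have 1: "norm (ip u w) \<le> N * norm (w - k) + s * N * norm (the (C k))"
      by (simp add: mult.assoc)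
    have "(norm w)\<^sup>2 = norm (ip w w)" by (simp add: ip_self norm_power)
    also have "\<dots> = norm (ip (w - u) w + ip u w)" by (simp add: ip_diff_left)
    also have "\<dots> \<le> norm (w - u) * norm w + norm (ip u w)"
      by (rule order_trans[OF norm_triangle_ineq add_right_mono[OF norm_ip_le]])
    also have "\<dots> \<le> s * norm w + norm (ip u w)"
      using u(2) by (intro add_right_mono mult_right_mono) (auto simp: dist_norm norm_minus_commute)
    finally show ?thesis using 1 by simp
  qed
  \<comment> \<open>The order of the limits matters: \<open>s\<close> tends to zero for fixed \<open>k\<close>, as \<open>C k\<close> need not stay
    bounded when \<open>k\<close> tends to \<open>w\<close>.\<close>
  have "(norm w)\<^sup>2 \<le> N * norm (w - k)" if k: "k \<in> dom B" for k
  proof (rule tendsto_lowerbound)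
    show "((\<lambda>s. s * norm w + (N * norm (w - k) + s * N * norm (the (C k))))
        \<longlongrightarrow> N * norm (w - k)) (at_right 0)"
      by (auto intro!: tendsto_eq_intros)
    show "\<forall>\<^sub>F s in at_right 0.
        (norm w)\<^sup>2 \<le> s * norm w + (N * norm (w - k) + s * N * norm (the (C k)))"
      unfolding eventually_at_right_field using est k by (intro exI[of _ 1]) auto
  qed simp
  then have "dom B \<subseteq> {k. (norm w)\<^sup>2 \<le> N * norm (w - k)}" by blast
  moreover have "closed {k. (norm w)\<^sup>2 \<le> N * norm (w - k)}"
    by (intro closed_Collect_le continuous_intros)
  ultimately have "(norm w)\<^sup>2 \<le> N * norm (w - w)"
    using closure_minimal dd unfolding densely_defined_def by blast
  then show "w = 0" by simp
qed

end

section \<open>The square of a Hilbert space\<close>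

definition prod_scale :: "('k \<Rightarrow> 'a \<Rightarrow> 'a) \<Rightarrow> 'k \<Rightarrow> 'a \<times> 'a \<Rightarrow> 'a \<times> 'a"
  where "prod_scale sc c p = (sc c (fst p), sc c (snd p))"

definition prod_ip :: "('a \<Rightarrow> 'a \<Rightarrow> 'k::plus) \<Rightarrow> 'a \<times> 'a \<Rightarrow> 'a \<times> 'a \<Rightarrow> 'k"
  where "prod_ip ip p q = ip (fst p) (fst q) + ip (snd p) (snd q)"

lemma (in hilbert_space) hilbert_space_prod: "hilbert_space (prod_scale scaleK) (prod_ip ip)"
proof unfold_locales
  fix x y z :: "'a \<times> 'a" and a b :: 'k and r :: real
  show "prod_scale scaleK (of_real r) x = r *\<^sub>R x"
    by (simp add: prod_scale_def scale_of_real prod_eq_iff)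
  show "to_complex (prod_ip ip x y) = cnj (to_complex (prod_ip ip y x))"
    by (simp add: prod_ip_def to_complex_add ip_commute[of "fst x"] ip_commute[of "snd x"])
  show "prod_ip ip x x = of_real ((norm x)\<^sup>2)"
    by (simp add: prod_ip_def ip_self norm_prod_def)
qed (auto simp: prod_scale_def prod_ip_def scale_right_distrib scale_left_distrib ip_add_left
    ip_scale_left algebra_simps)

definition op_diag :: "'a::banach operator \<Rightarrow> ('a \<times> 'a) operator"
  where "op_diag T =
    (\<lambda>(x, y). if x \<in> dom T \<and> y \<in> dom T then Some (the (T x), the (T y)) else None)"

text \<open>
  On pairs \<open>(x, y)\<close>, read as \<open>x + i y\<close>, this is \<open>A - i\<close>; the definition makes sense over the
  reals as well.
\<close>

definition op_rot :: "'a::banach operator \<Rightarrow> ('a \<times> 'a) operator"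
  where "op_rot A =
    (\<lambda>(x, y). if x \<in> dom A \<and> y \<in> dom A then Some (the (A x) + y, the (A y) - x) else None)"

lemma dom_op_diag: "dom (op_diag T) = dom T \<times> dom T"
  by (auto simp: op_diag_def split: if_splits)

lemma dom_op_rot: "dom (op_rot A) = dom A \<times> dom A"
  by (auto simp: op_rot_def split: if_splits)

lemma the_op_diag: "x \<in> dom T \<Longrightarrow> y \<in> dom T \<Longrightarrow> the (op_diag T (x, y)) = (the (T x), the (T y))"
  by (auto simp: op_diag_def)

lemma the_op_rot: "x \<in> dom A \<Longrightarrow> y \<in> dom A \<Longrightarrow> the (op_rot A (x, y)) = (the (A x) + y, the (A y) - x)"
  by (auto simp: op_rot_def)

lemma op_rot_sum: "op_rot (op_sum S T) = op_sum (op_rot S) (op_diag T)"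
proof
  fix p :: "'a \<times> 'a"
  show "op_rot (op_sum S T) p = op_sum (op_rot S) (op_diag T) p"
    by (cases p) (simp add: op_rot_def op_sum_def op_diag_def domIff)
qed

context hilbert_space
begin

lemma
  assumes A: "linear_operator scaleK A"
  shows linear_op_diag: "linear_operator (prod_scale scaleK) (op_diag A)"
    and linear_op_rot: "linear_operator (prod_scale scaleK) (op_rot A)"
proof -
  interpret P: hilbert_space "prod_scale scaleK" "prod_ip ip" by (rule hilbert_space_prod)
  have D: "subspace (dom A)" using A by (simp add: linear_operator_def)
  have DD: "P.subspace (dom A \<times> dom A)"
    using subspace_0[OF D] subspace_add[OF D] subspace_scale[OF D]
    by (intro P.subspaceI) (auto simp: prod_scale_def zero_prod_def iff del: domIff)
  have add: "\<And>x y. x \<in> dom A \<Longrightarrow> y \<in> dom A \<Longrightarrow> the (A (x + y)) = the (A x) + the (A y)"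
    and sc: "\<And>c x. x \<in> dom A \<Longrightarrow> the (A (scaleK c x)) = scaleK c (the (A x))"
    using A by (auto simp: linear_operator_def)
  note closed = subspace_add[OF D] subspace_scale[OF D]
  show "linear_operator (prod_scale scaleK) (op_diag A)"
    unfolding linear_operator_def dom_op_diag using DD
    by (auto simp: the_op_diag add sc closed prod_scale_def iff del: domIff)
  show "linear_operator (prod_scale scaleK) (op_rot A)"
    unfolding linear_operator_def dom_op_rot using DD
    by (auto simp: the_op_rot add sc closed prod_scale_def scale_right_distrib
        scale_right_diff_distrib algebra_simps iff del: domIff)
qed

text \<open>
  With \<open>a = A x\<close> and \<open>b = A y\<close> the assumption is an instance of the symmetry of \<open>A\<close>; it makes the
  mixed terms of the two components cancel.
\<close>

lemma norm_rotated_sq: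
  assumes "ip a y = ip x b"
  shows "(norm (a + y, b - x))\<^sup>2 = (norm (a, b))\<^sup>2 + (norm (x, y))\<^sup>2"
proof -
  have "ip y a = ip b x"
    using assms by (metis ip_commute to_complex_eq_iff)
  with assms have "(of_real ((norm (a + y))\<^sup>2 + (norm (b - x))\<^sup>2) :: 'k)
      = of_real ((norm a)\<^sup>2 + (norm b)\<^sup>2 + ((norm x)\<^sup>2 + (norm y)\<^sup>2))"
    by (simp only: ip_self[symmetric] of_real_add)
      (simp add: ip_add_left ip_add_right ip_diff_left ip_diff_right)
  then show ?thesis by (simp only: of_real_eq_iff) (simp add: norm_prod_def)
qed

section \<open>Essential selfadjointness as density of a range\<close>

lemma closure_graph_adjoint:
  assumes adj: "\<And>h. h \<in> dom A \<Longrightarrow> ip (the (A h)) k = ip h l"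
    and xy: "(x, y) \<in> closure (Map.graph A)"
  shows "ip y k = ip x l"
proof -
  let ?C = "{p. ip (snd p) k = ip (fst p) l}"
  have "closed ?C"
    by (intro closed_Collect_eq bounded_linear.continuous_on[OF bounded_linear_ip_left]
        continuous_intros)
  moreover have "Map.graph A \<subseteq> ?C" using adj by (force simp: graph_def)
  ultimately show ?thesis using closure_minimal[of "Map.graph A" ?C] xy by auto
qed

lemma op_closure_eq_Some_iff:
  assumes "densely_defined A" "symmetric_operator ip A"
  shows "op_closure A x = Some y \<longleftrightarrow> (x, y) \<in> closure (Map.graph A)"
  unfolding graph_op_closure[OF assms, symmetric] by (simp add: graph_def)

text \<open>
  The relation that defines the adjoint passes to limits in the graph of \<open>A\<close>
  (\<open>closure_graph_adjoint\<close>), so taking the closure leaves the adjoint unchanged.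
\<close>

lemma
  assumes dd: "densely_defined A" and sym: "symmetric_operator ip A"
  shows op_adjoint_op_closure_eq_Some_iff:
      "op_adjoint ip (op_closure A) k = Some l \<longleftrightarrow> (\<forall>h\<in>dom A. ip (the (A h)) k = ip h l)"
    and densely_defined_op_closure: "densely_defined (op_closure A)"
proof -
  note cl = op_closure_eq_Some_iff[OF dd sym]
  have ext: "op_closure A h = A h" if "h \<in> dom A" for h
    using that cl closure_subset by (force simp: graph_def)
  then have "dom A \<subseteq> dom (op_closure A)" by force
  with dd show dd': "densely_defined (op_closure A)"
    unfolding densely_defined_def by (metis closure_mono top.extremum_uniqueI)
  show "op_adjoint ip (op_closure A) k = Some l \<longleftrightarrow> (\<forall>h\<in>dom A. ip (the (A h)) k = ip h l)"
    unfolding op_adjoint_eq_Some_iff[OF dd']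
  proof
    assume "\<forall>h\<in>dom (op_closure A). ip (the (op_closure A h)) k = ip h l"
    then show "\<forall>h\<in>dom A. ip (the (A h)) k = ip h l" using ext by (metis domIff)
  next
    assume "\<forall>h\<in>dom A. ip (the (A h)) k = ip h l"
    then have adj: "ip y k = ip x l" if "(x, y) \<in> closure (Map.graph A)" for x y
      by (intro closure_graph_adjoint[OF _ that]) blast
    show "\<forall>h\<in>dom (op_closure A). ip (the (op_closure A h)) k = ip h l"
    proof
      fix h assume "h \<in> dom (op_closure A)"
      then obtain y where y: "op_closure A h = Some y" by blast
      then have "(h, y) \<in> closure (Map.graph A)" by (simp only: cl)
      then show "ip (the (op_closure A h)) k = ip h l" using adj[of h y] by (simp add: y)
    qed
  qed
qed

text \<open>
  The right hand side says \<open>A\<^sup>* y = z\<close> and \<open>A\<^sup>* z = -y\<close>; it comes from testing with the pairs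
  \<open>(h, 0)\<close> and \<open>(0, h)\<close>.
\<close>

lemma orthogonal_ran_op_rot_iff:
  assumes "linear_operator scaleK A"
  shows "(\<forall>h\<in>dom (op_rot A). prod_ip ip (the (op_rot A h)) (y, z) = 0) \<longleftrightarrow>
    (\<forall>h\<in>dom A. ip (the (A h)) y = ip h z \<and> ip (the (A h)) z = ip h (- y))"
proof -
  have 0: "0 \<in> dom A" "the (A 0) = 0"
  proof -
    have D: "subspace (dom A)" and add: "\<forall>x\<in>dom A. \<forall>y\<in>dom A. the (A (x + y)) = the (A x) + the (A y)"
      using assms by (auto simp: linear_operator_def)
    show "0 \<in> dom A" using subspace_0[OF D] .
    then have "the (A (0 + 0)) = the (A 0) + the (A 0)" using add by blast
    then show "the (A 0) = 0" by simp
  qed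
  have z: "ip 0 u = 0" "ip u 0 = 0" for u
    using ip_diff_left[of 0 0 u] ip_diff_right[of u 0 0] by auto
  have neg: "ip (- u) v = - ip u v" "ip u (- v) = - ip u v" for u v
    using ip_diff_left[of 0 u v] ip_diff_right[of u 0 v] z by auto
  show ?thesis
  proof
    assume L: "\<forall>h\<in>dom (op_rot A). prod_ip ip (the (op_rot A h)) (y, z) = 0"
    show "\<forall>h\<in>dom A. ip (the (A h)) y = ip h z \<and> ip (the (A h)) z = ip h (- y)"
    proof
      fix h assume h: "h \<in> dom A"
      have "prod_ip ip (the (op_rot A (h, 0))) (y, z) = 0"
        and "prod_ip ip (the (op_rot A (0, h))) (y, z) = 0"
        using L h 0 by (auto simp: dom_op_rot iff del: domIff)
      then show "ip (the (A h)) y = ip h z \<and> ip (the (A h)) z = ip h (- y)"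
        using h 0
        by (auto simp: the_op_rot prod_ip_def neg z add_eq_0_iff2 add_eq_0_iff iff del: domIff)
    qed
  next
    assume "\<forall>h\<in>dom A. ip (the (A h)) y = ip h z \<and> ip (the (A h)) z = ip h (- y)"
    then show "\<forall>h\<in>dom (op_rot A). prod_ip ip (the (op_rot A h)) (y, z) = 0"
      by (auto simp: dom_op_rot the_op_rot prod_ip_def ip_add_left ip_diff_left neg iff del: domIff)
  qed
qed

lemma subspace_graph:
  assumes "linear_operator scaleK A"
  shows "module.subspace (prod_scale scaleK) (Map.graph A)"
proof -
  interpret P: hilbert_space "prod_scale scaleK" "prod_ip ip" by (rule hilbert_space_prod)
  have D: "subspace (dom A)" using assms by (simp add: linear_operator_def)
  have add: "\<And>x y. x \<in> dom A \<Longrightarrow> y \<in> dom A \<Longrightarrow> the (A (x + y)) = the (A x) + the (A y)"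
    and sc: "\<And>c x. x \<in> dom A \<Longrightarrow> the (A (scaleK c x)) = scaleK c (the (A x))"
    using assms by (auto simp: linear_operator_def)
  have g: "p \<in> Map.graph A \<longleftrightarrow> fst p \<in> dom A \<and> snd p = the (A (fst p))" for p
    by (cases p) (auto simp: graph_def)
  have "the (A (0 + 0)) = the (A 0) + the (A 0)" using add subspace_0[OF D] by blast
  then have "the (A 0) = 0" by simp
  then show ?thesis
    using subspace_0[OF D]
    by (intro P.subspaceI)
      (auto simp: g prod_scale_def add sc subspace_add[OF D] subspace_scale[OF D] iff del: domIff)
qed

text \<open>
  As the closure of \<open>A\<close> is always contained in \<open>A\<^sup>*\<close>, essential selfadjointness says that the
  graph of \<open>A\<^sup>*\<close> is contained in the closure of the graph of \<open>A\<close>. A pair \<open>(y, z)\<close> orthogonal to the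
  range of \<open>op_rot A\<close> satisfies \<open>A\<^sup>* y = z\<close>, \<open>A\<^sup>* z = -y\<close>. If the closure of \<open>A\<close> is \<open>A\<^sup>*\<close>, then
  \<open>A\<^sup>*\<close> is symmetric and \<open>\<parallel>z\<parallel>\<^sup>2 = (z | A\<^sup>* y) = (A\<^sup>* z | y) = - \<parallel>y\<parallel>\<^sup>2\<close>, so that the pair vanishes.
  Conversely, for \<open>(k, l)\<close> in the graph of \<open>A\<^sup>*\<close>, the difference of \<open>(k, l)\<close> and its projection to the
  closed graph of \<open>A\<close> is such a pair; if it vanishes, \<open>(k, l)\<close> lies in the closed graph.
\<close>

lemma essentially_selfadjoint_iff_dense_ran:
  assumes A: "linear_operator scaleK A" and dd: "densely_defined A" and sym: "symmetric_operator ip A"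
  shows "essentially_selfadjoint ip A \<longleftrightarrow> closure (ran (op_rot A)) = UNIV"
proof -
  interpret P: hilbert_space "prod_scale scaleK" "prod_ip ip" by (rule hilbert_space_prod)
  note adj = op_adjoint_op_closure_eq_Some_iff[OF dd sym]
  note cl = op_closure_eq_Some_iff[OF dd sym]
  have sub: "\<forall>h\<in>dom A. ip (the (A h)) k = ip h l" if kl: "(k, l) \<in> closure (Map.graph A)" for k l
  proof
    fix h assume h: "h \<in> dom A"
    have "ip l h = ip k (the (A h))"
      using sym h by (intro closure_graph_adjoint[OF _ kl]) (auto simp: symmetric_operator_def)
    then show "ip (the (A h)) k = ip h l" by (metis ip_commute to_complex_eq_iff)
  qed
  have "essentially_selfadjoint ip A \<longleftrightarrow> op_closure A = op_adjoint ip (op_closure A)"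
    using dd sym densely_defined_op_closure[OF dd sym]
    by (simp add: essentially_selfadjoint_def selfadjoint_def)
  also have "\<dots> \<longleftrightarrow> (\<forall>k l. op_closure A k = Some l \<longleftrightarrow> op_adjoint ip (op_closure A) k = Some l)"
    by (metis (no_types) option.exhaust ext)
  also have "\<dots> \<longleftrightarrow>
      (\<forall>k l. (\<forall>h\<in>dom A. ip (the (A h)) k = ip h l) \<longrightarrow> (k, l) \<in> closure (Map.graph A))"
    unfolding adj cl using sub by blast
  also have "\<dots> \<longleftrightarrow> (\<forall>y z. (\<forall>h\<in>dom A. ip (the (A h)) y = ip h z \<and> ip (the (A h)) z = ip h (- y))
      \<longrightarrow> (y, z) = 0)" (is "?L \<longleftrightarrow> ?R")
  proof
    assume L: ?L
    show ?R
    proof (intro allI impI)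
      fix y z assume yz: "\<forall>h\<in>dom A. ip (the (A h)) y = ip h z \<and> ip (the (A h)) z = ip h (- y)"
      then have "(z, - y) \<in> closure (Map.graph A)" using L by blast
      then have "ip (- y) y = ip z z" using yz by (intro closure_graph_adjoint[of A y z z "- y"]) blast+
      then have "prod_ip ip (y, z) (y, z) = 0"
        using ip_diff_left[of 0 y y] ip_diff_left[of 0 0 y] by (simp add: prod_ip_def)
      then show "(y, z) = 0" unfolding P.ip_self by simp
    qed
  next
    assume R: ?R
    show ?L
    proof (intro allI impI)
      fix k l assume kl: "\<forall>h\<in>dom A. ip (the (A h)) k = ip h l"
      obtain p where p: "p \<in> closure (Map.graph A)"
        and orth: "\<And>m. m \<in> Map.graph A \<Longrightarrow> prod_ip ip m ((k, l) - p) = 0"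
        using P.orthogonal_projection[OF subspace_graph[OF A], of "(k, l)"] by blast
      obtain a b where ab: "p = (a, b)" by (cases p)
      \<comment> \<open>The first equation holds since \<open>(k, l)\<close> and \<open>(a, b)\<close> both lie in the graph of the
        adjoint, the second one since their difference is orthogonal to the graph of \<open>A\<close>.\<close>
      have "ip (the (A h)) (k - a) = ip h (l - b) \<and> ip (the (A h)) (l - b) = ip h (- (k - a))"
        if h: "h \<in> dom A" for h
      proof
        show "ip (the (A h)) (k - a) = ip h (l - b)"
          using kl sub[of a b] p h by (simp add: ab ip_diff_right)
        have "ip h (k - a) + ip (the (A h)) (l - b) = 0"
          using orth[of "(h, the (A h))"] h by (auto simp: ab prod_ip_def graph_def)
        then show "ip (the (A h)) (l - b) = ip h (- (k - a))"
          using ip_diff_right[of h 0 "k - a"] ip_diff_right[of h 0 0]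
          by (simp add: add_eq_0_iff)
      qed
      then have "(k - a, l - b) = 0" using R by blast
      then show "(k, l) \<in> closure (Map.graph A)" using p by (simp add: ab zero_prod_def)
    qed
  qed
  also have "\<dots> \<longleftrightarrow> closure (ran (op_rot A)) = UNIV"
    unfolding P.dense_ran_iff[OF linear_op_rot[OF A]] split_paired_All orthogonal_ran_op_rot_iff[OF A] ..
  finally show ?thesis .
qed

end

section \<open>Essential selfadjointness of the perturbed operator\<close>

theorem corollary3p7:
  fixes scaleK :: "'k::real_or_complex \<Rightarrow> 'a::banach \<Rightarrow> 'a"
    and ip :: "'a \<Rightarrow> 'a \<Rightarrow> 'k"
    and S T :: "'a operator"
  assumes "hilbert_space scaleK ip"
    and "linear_operator scaleK S" and "linear_operator scaleK T"
    and "essentially_selfadjoint ip S" and "dom S \<subseteq> dom T"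
    and "\<And>h. h \<in> dom S \<Longrightarrow> (norm (the (T h)))\<^sup>2 \<le> (norm (the (S h)))\<^sup>2 + (norm h)\<^sup>2"
    and "\<And>h k. h \<in> dom S \<Longrightarrow> k \<in> dom S \<Longrightarrow> ip (the (T h)) k = ip h (the (T k))"
  shows "essentially_selfadjoint ip (op_sum S T)"
proof -
  interpret hilbert_space scaleK ip by (rule assms(1))
  interpret P: hilbert_space "prod_scale scaleK" "prod_ip ip" by (rule hilbert_space_prod)
  note S = assms(2) and T = assms(3) and dom = assms(5) and bound = assms(6) and symT = assms(7)
  have dd: "densely_defined S" and symS: "symmetric_operator ip S"
    using assms(4) by (auto simp: essentially_selfadjoint_def)
  have domsum: "dom (op_sum S T) = dom S" using dom by (auto simp: dom_op_sum)
  have dd': "densely_defined (op_sum S T)" using dd by (simp add: densely_defined_def domsum)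
  have sym': "symmetric_operator ip (op_sum S T)"
    using symS symT dom unfolding symmetric_operator_def domsum
    by (auto simp: the_op_sum subset_iff ip_add_left ip_add_right iff del: domIff)
  \<comment> \<open>The norm identity for \<open>S + t T\<close>. The value \<open>t = 0\<close> turns the hypothesis on \<open>T\<close> into
    domination by \<open>op_rot S\<close>, and general \<open>t\<close> gives the uniform lower bound.\<close>
  have rot: "(norm (the (S x) + t *\<^sub>R the (T x) + y, the (S y) + t *\<^sub>R the (T y) - x))\<^sup>2
      = (norm (the (S x) + t *\<^sub>R the (T x), the (S y) + t *\<^sub>R the (T y)))\<^sup>2 + (norm (x, y))\<^sup>2"
    if "x \<in> dom S" "y \<in> dom S" for x y t
    using symS symT[OF that] that
    by (intro norm_rotated_sq)
      (simp add: symmetric_operator_def ip_add_left ip_add_right ip_scaleR)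
  have "closure (ran (op_sum (op_rot S) (op_diag T))) = UNIV"
  proof (rule P.dense_ran_sum_borderline[OF linear_op_rot[OF S] linear_op_diag[OF T]])
    show "dom (op_rot S) \<subseteq> dom (op_diag T)"
      using dom by (auto simp: dom_op_rot dom_op_diag iff del: domIff)
    show "densely_defined (op_rot S)"
      using dd by (simp add: densely_defined_def dom_op_rot closure_Times)
    show "closure (ran (op_rot S)) = UNIV"
      using essentially_selfadjoint_iff_dense_ran[OF S dd symS] assms(4) by simp
  next
    fix h assume "h \<in> dom (op_rot S)"
    then obtain x y where xy: "h = (x, y)" "x \<in> dom S" "y \<in> dom S"
      by (cases h) (auto simp: dom_op_rot iff del: domIff)
    have T': "x \<in> dom T" "y \<in> dom T" using xy dom by auto
    have "(norm (the (T x), the (T y)))\<^sup>2 \<le> (norm (the (S x), the (S y)))\<^sup>2 + (norm (x, y))\<^sup>2"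
      using bound[OF xy(2)] bound[OF xy(3)] by (simp add: norm_prod_def)
    also have "\<dots> = (norm (the (S x) + y, the (S y) - x))\<^sup>2"
      using rot[OF xy(2,3), of 0] by simp
    finally show "norm (the (op_diag T h)) \<le> norm (the (op_rot S h))"
      using xy T' by (simp add: the_op_diag the_op_rot)
    fix t :: real
    have "(norm (x, y))\<^sup>2
        \<le> (norm (the (S x) + t *\<^sub>R the (T x) + y, the (S y) + t *\<^sub>R the (T y) - x))\<^sup>2"
      unfolding rot[OF xy(2,3)] by simp
    then have "norm (x, y)
        \<le> norm (the (S x) + t *\<^sub>R the (T x) + y, the (S y) + t *\<^sub>R the (T y) - x)"
      by simp
    then show "norm h \<le> norm (the (op_rot S h) + t *\<^sub>R the (op_diag T h))"
      using xy T' by (simp add: the_op_diag the_op_rot algebra_simps)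
  next
    fix h k assume "h \<in> dom (op_rot S)" "k \<in> dom (op_rot S)"
    then show "prod_ip ip (the (op_diag T h)) k = prod_ip ip h (the (op_diag T k))"
      using symT dom
      by (cases h; cases k) (auto simp: dom_op_rot the_op_diag prod_ip_def subset_iff iff del: domIff)
  qed
  then show ?thesis
    using essentially_selfadjoint_iff_dense_ran[OF linear_operator_sum[OF S T] dd' sym']
    by (simp add: op_rot_sum)
qed

end
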